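(* For integers $m\ge n\ge0$ let $\lambda=\sqrt{(n+m+1)^2+n+m+1}$ and $s=m-n\ge0$. If $m=m(n)$ is such that $\dfrac{s}{\lambda}\to0$ as $n\to\infty$, then for real $x$ $$P_{2n+1}^{(m-n)}(x)=(-1)^n\,\frac{(2n+1)!}{n!\,m!}\,(1+x^2)^{\frac{n+m+1}{2}}\left(\frac{1}{1+x^2}-\frac{s^2}{\lambda^2}\right)^{-1/4}\left(1-\frac{s^2}{\lambda^2}\right)^{-1/4}\cdot\frac{2}{\lambda}\left(\sin y+O\left(\frac{1}{n+m}\right)\right)$$ as $n\to\infty$, where $$y=\lambda\int_0^{\operatorname{arsinh}x}\sqrt{\frac{1}{\cosh^2\tau}-\frac{s^2}{\lambda^2}}\,d\tau.$$ The estimate of the remainder is uniform on any bounded set of $x$.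
   Context: For integers $N\ge0$ and $s\ge0$, the polynomials $P_N^{(s)}(x)$ of degree $N$ are defined by $$P_N^{(s)}(x)=\sum_{k=0}^{[N/2]}(-1)^k\frac{N!\,(2x)^{N-2k}}{k!\,(N-2k)!\,(s+k)!},$$ where $[\cdot]$ is the integer part. *)

theory Defs
  imports "HOL-Analysis.Analysis"
begin

definition polyP :: "nat \<Rightarrow> nat \<Rightarrow> real \<Rightarrow> real" where
  "polyP N s x = (\<Sum>k\<le>N div 2. (-1) ^ k * (fact N * (2 * x) ^ (N - 2 * k)) /
                (fact k * fact (N - 2 * k) * fact (s + k)))"

definition lam :: "nat \<Rightarrow> nat \<Rightarrow> real" where
  "lam n m = sqrt ((real n + real m + 1)\<^sup>2 + real n + real m + 1)"

(* The interval integral is oriented, hence negative for x < 0. *)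
definition phase :: "nat \<Rightarrow> nat \<Rightarrow> real \<Rightarrow> real" where
  "phase n m x = lam n m *
     (LBINT \<tau>=0..arsinh x. sqrt (1 / (cosh \<tau>)\<^sup>2 - (real (m - n))\<^sup>2 / (lam n m)\<^sup>2))"

end

theory Submission
  imports Defs
begin

text \<open>The polynomial \<open>P = P\<^sub>2\<^sub>n\<^sub>+\<^sub>1\<close> satisfies a second-order linear equation which, for
  \<open>u(t) = P(sinh t) / cosh\<^sup>n\<^sup>+\<^sup>m\<^sup>+\<^sup>1 t\<close>, becomes \<open>u'' + \<lambda>\<^sup>2 q u = 0\<close> with
  \<open>q(t) = 1 / cosh\<^sup>2 t - s\<^sup>2 / \<lambda>\<^sup>2\<close>. As \<open>s / \<lambda> \<rightarrow> 0\<close>, \<open>q\<close> is eventually bounded away from \<open>0\<close> on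
  compact sets, so the Liouville--Green approximation of the odd solution \<open>u\<close> has a relative
  error \<open>O(1/\<lambda>)\<close> there.\<close>

section \<open>The differential equation\<close>

definition polyP_coeff :: "nat \<Rightarrow> nat \<Rightarrow> nat \<Rightarrow> real" where
  "polyP_coeff N s k = (-1) ^ k * (fact N * 2 ^ (N - 2 * k)) / (fact k * fact (N - 2 * k) * fact (s + k))"

text \<open>Natural-number subtraction in the exponents, here and in \<open>polyP''\<close>, is
  harmless: wherever an exponent is cut off at 0, one of the factors \<open>real (N - 2 * k)\<close>
  and \<open>real (N - 2 * k - 1)\<close> is 0.\<close>

definition polyP' :: "nat \<Rightarrow> nat \<Rightarrow> real \<Rightarrow> real" where
  "polyP' N s x = (\<Sum>k\<le>N div 2. polyP_coeff N s k * (real (N - 2 * k) * x ^ (N - 2 * k - 1)))"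

definition polyP'' :: "nat \<Rightarrow> nat \<Rightarrow> real \<Rightarrow> real" where
  "polyP'' N s x = (\<Sum>k\<le>N div 2. polyP_coeff N s k *
     (real (N - 2 * k) * (real (N - 2 * k - 1) * x ^ (N - 2 * k - 2))))"

lemma polyP_altdef: "polyP N s x = (\<Sum>k\<le>N div 2. polyP_coeff N s k * x ^ (N - 2 * k))"
  by (simp add: polyP_def polyP_coeff_def power_mult_distrib mult_ac)

lemma DERIV_polyP: "(polyP N s has_real_derivative polyP' N s x) (at x)"
  unfolding polyP_altdef[abs_def] polyP'_def
  by (auto intro!: derivative_eq_intros sum.cong simp: mult_ac)

lemma DERIV_polyP': "(polyP' N s has_real_derivative polyP'' N s x) (at x)"
  unfolding polyP'_def[abs_def] polyP''_def
  by (auto intro!: derivative_eq_intros sum.cong simp: mult_ac diff_diff_eq)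

text \<open>Ratio of consecutive coefficients, cleared of denominators. This recurrence is what
  makes the sum in the differential equation telescope.\<close>

lemma polyP_coeff_Suc:
  assumes "2 * Suc k \<le> N"
  shows "4 * real (Suc k) * real (s + Suc k) * polyP_coeff N s (Suc k) =
    - (real (N - 2 * k) * real (N - 2 * k - 1)) * polyP_coeff N s k"
proof -
  obtain j where N: "N = 2 * Suc k + j"
    using assms le_Suc_ex by blast
  show ?thesis
    unfolding polyP_coeff_def N by (simp add: divide_simps del: of_nat_Suc)
qed

text \<open>Writing \<open>\<theta> = x d/dx\<close>, the recurrence for the coefficients says
  \<open>P'' + (N - \<theta>)(N + 2s - \<theta>)P = 0\<close>; the sum over \<open>k\<close> telescopes.\<close>

lemma polyP_ode:
  "(1 + x\<^sup>2) * polyP'' N s x - (2 * real N + 2 * real s - 1) * x * polyP' N s x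
     + real N * (real N + 2 * real s) * polyP N s x = 0"
proof -
  \<comment> \<open>On x^(N - 2k) the operator (N - \<theta>)(N + 2s - \<theta>) acts as
    multiplication by 2k * 2(s + k), which gives \<open>D k\<close>. By
    \<open>polyP_coeff_Suc\<close> the remaining term, from P'', is
    \<open>- D (Suc k)\<close>.\<close>
  define D where "D k = 4 * real k * real (s + k) * polyP_coeff N s k * x ^ (N - 2 * k)" for k
  \<comment> \<open>The cut-off is needed because \<open>polyP_coeff\<close> does not vanish beyond
    \<open>N div 2\<close>, whereas the P'' term of the last summand does.\<close>
  define D' where "D' k = (if k \<le> N div 2 then D k else 0)" for k
  have step: "(1 + x\<^sup>2) * (polyP_coeff N s k * (real (N - 2 * k) * (real (N - 2 * k - 1) * x ^ (N - 2 * k - 2))))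
     - (2 * real N + 2 * real s - 1) * x * (polyP_coeff N s k * (real (N - 2 * k) * x ^ (N - 2 * k - 1)))
     + real N * (real N + 2 * real s) * (polyP_coeff N s k * x ^ (N - 2 * k)) = D' k - D' (Suc k)"
    if "k \<le> N div 2" for k
  proof -
    have "2 * k \<le> N"
      using that by simp
    then obtain j where N: "N = 2 * k + j"
      using le_Suc_ex by blast
    show ?thesis
    proof (cases "j \<ge> 2")
      case True
      then obtain i where j: "j = Suc (Suc i)"
        by (metis add_2_eq_Suc le_Suc_ex)
      have "D' (Suc k) = - (real j * real (j - 1)) * polyP_coeff N s k * x ^ i"
        using polyP_coeff_Suc[of k N s] N j by (simp add: D'_def D_def)
      then show ?thesis
        using that by (simp add: D'_def D_def N j algebra_simps power2_eq_square)
    next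
      case False
      then have "j = 0 \<or> j = 1" by auto
      then show ?thesis
        using that N by (auto simp: D'_def D_def algebra_simps)
    qed
  qed
  have "(1 + x\<^sup>2) * polyP'' N s x - (2 * real N + 2 * real s - 1) * x * polyP' N s x
      + real N * (real N + 2 * real s) * polyP N s x = (\<Sum>k\<le>N div 2. D' k - D' (Suc k))"
    unfolding polyP_altdef polyP'_def polyP''_def sum_distrib_left
      sum_subtractf[symmetric] sum.distrib[symmetric]
    by (intro sum.cong refl step) simp
  also have "\<dots> = D' 0 - D' (Suc (N div 2))"
    by (rule sum_telescope)
  also have "\<dots> = 0"
    by (simp add: D'_def D_def)
  finally show ?thesis .
qed

lemma polyP_odd_0: "polyP (2 * n + 1) s 0 = 0"
  by (auto simp: polyP_altdef intro!: sum.neutral)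

text \<open>Only the summand \<open>k = n\<close> is linear in x. As the polynomial vanishes at 0,
  this slope alone fixes the sign and amplitude of the solution.\<close>

lemma polyP'_odd_0: "polyP' (2 * n + 1) s 0 = (-1) ^ n * (2 * fact (2 * n + 1) / (fact n * fact (s + n)))"
proof -
  have "polyP' (2 * n + 1) s 0 = (\<Sum>k\<in>{n}. polyP_coeff (2 * n + 1) s k *
      (real (2 * n + 1 - 2 * k) * 0 ^ (2 * n + 1 - 2 * k - 1)))"
    unfolding polyP'_def by (intro sum.mono_neutral_right) auto
  then show ?thesis
    by (simp add: polyP_coeff_def)
qed

section \<open>Liouville normal form in the variable t = arsinh x\<close>

lemma lam_squared: "(lam n m)\<^sup>2 = (real n + real m + 1)\<^sup>2 + real n + real m + 1"
  unfolding lam_def by (simp add: add_nonneg_nonneg)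

text \<open>Turns a remainder of order 1/\<lambda> into one of order 1/(n + m), and gives \<lambda>
  > 0.\<close>

lemma lam_gt: "real n + real m < lam n m"
  unfolding lam_def by (rule real_less_rsqrt) (simp add: power2_eq_square algebra_simps add_pos_nonneg)

lemma sech_squared: "1 / (cosh t)\<^sup>2 = 1 - (tanh t)\<^sup>2" for t :: real
  by (simp add: tanh_def power_divide divide_simps) (simp add: cosh_square_eq)

text \<open>With N = 2n + 1 and s = m - n one has N + s = L, so x = sinh t turns the first-order
  term into -2L tanh t d/dt, which division by \<open>cosh t ^ L\<close> removes. The potential
  results from (2n + 1)(2m + 1) = L^2 - s^2 and \<lambda>^2 = L^2 + L.\<close>

lemma liouville_normal_form:
  fixes n m :: nat
  assumes "n \<le> m"
  defines "L \<equiv> n + m + 1"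
  defines "P \<equiv> polyP (2 * n + 1) (m - n)" and "P' \<equiv> polyP' (2 * n + 1) (m - n)"
  shows "((\<lambda>t. P (sinh t) / cosh t ^ L) has_real_derivative
           (P' (sinh t) * cosh t - L * P (sinh t) * tanh t) / cosh t ^ L) (at t)"
    and "((\<lambda>t. (P' (sinh t) * cosh t - L * P (sinh t) * tanh t) / cosh t ^ L) has_real_derivative
           - ((lam n m)\<^sup>2 / (cosh t)\<^sup>2 - (real (m - n))\<^sup>2) * (P (sinh t) / cosh t ^ L)) (at t)"
proof -
  define P'' where "P'' = polyP'' (2 * n + 1) (m - n)"
  define h where "h t = inverse (cosh t ^ L)" for t :: real
  have [derivative_intros]: "(h has_real_derivative - (L * tanh t * h t)) (at t)" for t
  proof -
    have "((\<lambda>t. cosh t ^ L) has_real_derivative real L * cosh t ^ (n + m) * sinh t) (at t)"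
      by (rule DERIV_cong[OF DERIV_power[OF has_field_derivative_cosh[OF DERIV_ident]]]) (simp add: L_def)
    from DERIV_inverse'[OF this] show ?thesis
      unfolding h_def[abs_def] by (rule DERIV_cong) (simp_all add: tanh_def L_def field_simps)
  qed
  have [derivative_intros]: "((\<lambda>t. P (sinh t)) has_real_derivative P' (sinh t) * cosh t) (at t)" for t
    unfolding P_def P'_def
    by (rule DERIV_cong[OF DERIV_chain2[OF DERIV_polyP has_field_derivative_sinh[OF DERIV_ident]]]) simp
  have [derivative_intros]: "((\<lambda>t. P' (sinh t)) has_real_derivative P'' (sinh t) * cosh t) (at t)" for t
    unfolding P''_def P'_def
    by (rule DERIV_cong[OF DERIV_chain2[OF DERIV_polyP' has_field_derivative_sinh[OF DERIV_ident]]]) simp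
  show "((\<lambda>t. P (sinh t) / cosh t ^ L) has_real_derivative
           (P' (sinh t) * cosh t - L * P (sinh t) * tanh t) / cosh t ^ L) (at t)"
    unfolding divide_inverse h_def [symmetric]
    by (auto intro!: derivative_eq_intros simp: algebra_simps)
  define th where "th = tanh t"
  define p where "p = P (sinh t)"
  define p' where "p' = P' (sinh t)"
  define p'' where "p'' = P'' (sinh t)"
  have sinh: "sinh t = th * cosh t"
    by (simp add: th_def tanh_def)
  have ch: "1 + (sinh t)\<^sup>2 = (cosh t)\<^sup>2"
    by (simp add: cosh_square_eq)
  have sech: "(lam n m)\<^sup>2 / (cosh t)\<^sup>2 = (lam n m)\<^sup>2 * (1 - th\<^sup>2)"
    using sech_squared[of t] by (simp add: th_def divide_inverse)
  have s: "real (m - n) = real m - real n"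
    using assms by simp
  have ode: "(cosh t)\<^sup>2 * p'' = (2 * L - 1) * (th * cosh t) * p' - (2 * n + 1) * (2 * m + 1) * p"
    using polyP_ode[of "sinh t" "2 * n + 1" "m - n"]
    unfolding ch P_def[symmetric] P'_def[symmetric] P''_def[symmetric] p_def[symmetric] p'_def[symmetric] p''_def[symmetric]
    by (simp add: s sinh L_def algebra_simps)
  \<comment> \<open>This is the second derivative with the factor \<open>h t\<close> removed.
    Eliminating \<open>p''\<close> through \<open>ode\<close> leaves a polynomial identity in
    \<open>th\<close>, \<open>cosh t\<close>, \<open>p\<close> and \<open>p'\<close>.\<close>
  have *: "(p'' * cosh t * cosh t + sinh t * p' - L * p * (1 - th\<^sup>2) - L * (p' * cosh t) * th)
        - L * th * (p' * cosh t - L * p * th)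
      = - ((lam n m)\<^sup>2 * (1 - th\<^sup>2) - (real (m - n))\<^sup>2) * p"
  proof -
    have "p'' * cosh t * cosh t = (2 * L - 1) * (th * cosh t) * p' - (2 * n + 1) * (2 * m + 1) * p"
      using ode by (simp add: power2_eq_square mult_ac)
    then show ?thesis
      unfolding sinh lam_squared s L_def by (simp add: algebra_simps power2_eq_square)
  qed
  show "((\<lambda>t. (P' (sinh t) * cosh t - L * P (sinh t) * tanh t) / cosh t ^ L) has_real_derivative
           - ((lam n m)\<^sup>2 / (cosh t)\<^sup>2 - (real (m - n))\<^sup>2) * (P (sinh t) / cosh t ^ L)) (at t)"
    unfolding divide_inverse[of _ "_ ^ L"] h_def [symmetric]
    apply (rule derivative_eq_intros refl cosh_real_nonzero | simp)+
    unfolding p_def[symmetric] p'_def[symmetric] p''_def[symmetric] th_def[symmetric] sech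
    using arg_cong[OF *, of "\<lambda>z. z * h t"]
    by (simp add: algebra_simps)
qed

section \<open>The Liouville--Green estimate\<close>

text \<open>Since \<phi>' = l / g^2, the functions g sin \<phi> and g cos \<phi> solve y'' = (g''/g
  - l^2/g^4) y, which differs from the equation for u only by the term g''/g. The error is measured
  against the amplitude, not against the sine, which has zeros.\<close>

lemma liouville_green_estimate:
  fixes u u' g g' g'' \<phi> :: "real \<Rightarrow> real"
  assumes T: "T > 0" and l: "l > 0" and small: "4 * K * T \<le> l"
    and u: "\<And>t. t \<in> {-T..T} \<Longrightarrow> (u has_real_derivative u' t) (at t within {-T..T})"
    and u': "\<And>t. t \<in> {-T..T} \<Longrightarrow> (u' has_real_derivative - (l\<^sup>2 / g t ^ 4) * u t) (at t within {-T..T})"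
    and g: "\<And>t. t \<in> {-T..T} \<Longrightarrow> (g has_real_derivative g' t) (at t within {-T..T})"
    and g': "\<And>t. t \<in> {-T..T} \<Longrightarrow> (g' has_real_derivative g'' t) (at t within {-T..T})"
    and phi: "\<And>t. t \<in> {-T..T} \<Longrightarrow> (\<phi> has_real_derivative l / (g t)\<^sup>2) (at t within {-T..T})"
    and gpos: "\<And>t. t \<in> {-T..T} \<Longrightarrow> g t > 0"
    and K: "\<And>t. t \<in> {-T..T} \<Longrightarrow> \<bar>g t * g'' t\<bar> \<le> K"
    and init: "u 0 = 0" "\<phi> 0 = 0"
    and t: "t \<in> {-T..T}"
  shows "\<bar>u t - u' 0 * g 0 / l * g t * sin (\<phi> t)\<bar> \<le> \<bar>u' 0 * g 0 / l\<bar> * g t * (4 * K * T / l)"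
proof -
  text \<open>With \<open>S = g sin \<phi>\<close> and \<open>C = g cos \<phi>\<close>, variation of parameters gives
    \<open>u = \<alpha> S - \<beta> C\<close>, and \<open>\<alpha>\<close>, \<open>\<beta>\<close> are almost constant.\<close>
  let ?I = "{-T..T}"
  \<comment> \<open>\<open>\<alpha>\<close> and \<open>\<beta>\<close> are the Wronskians of u with
    C and with S, divided by the constant Wronskian \<open>l\<close> of C and S.\<close>
  define \<alpha> where "\<alpha> t = (u' t * (g t * cos (\<phi> t)) - u t * (g' t * cos (\<phi> t) - l / g t * sin (\<phi> t))) / l" for t
  define \<beta> where "\<beta> t = (u' t * (g t * sin (\<phi> t)) - u t * (g' t * sin (\<phi> t) + l / g t * cos (\<phi> t))) / l" for t
  have lne: "l \<noteq> 0"
    using l by simp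
  have gne: "g t \<noteq> 0" if "t \<in> ?I" for t
    using gpos[OF that] by simp
  have decomp: "u t = g t * (\<alpha> t * sin (\<phi> t) - \<beta> t * cos (\<phi> t))" if "t \<in> ?I" for t
  proof -
    define S C where "S = sin (\<phi> t)" and "C = cos (\<phi> t)"
    have "g t * (\<alpha> t * S - \<beta> t * C) = u t * (S\<^sup>2 + C\<^sup>2)"
      using gpos[OF that] l unfolding \<alpha>_def \<beta>_def S_def[symmetric] C_def[symmetric]
      by (simp add: divide_simps) (simp add: algebra_simps power2_eq_square)
    then show ?thesis by (simp add: S_def C_def)
  qed
  \<comment> \<open>The terms with l^2/g^4 cancel in the derivative of the Wronskian; what remains
    carries g'' and the factor 1/l.\<close>
  have da: "(\<alpha> has_real_derivative - (u t * g'' t * cos (\<phi> t)) / l) (at t within ?I)" if "t \<in> ?I" for t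
    unfolding \<alpha>_def[abs_def]
    apply (rule derivative_eq_intros u[OF that] u'[OF that] g[OF that] g'[OF that] phi[OF that]
      gne[OF that] lne refl)+
    using gpos[OF that] l
    by (simp add: divide_simps) (simp add: algebra_simps eval_nat_numeral)
  have db: "(\<beta> has_real_derivative - (u t * g'' t * sin (\<phi> t)) / l) (at t within ?I)" if "t \<in> ?I" for t
    unfolding \<beta>_def[abs_def]
    apply (rule derivative_eq_intros u[OF that] u'[OF that] g[OF that] g'[OF that] phi[OF that]
      gne[OF that] lne refl)+
    using gpos[OF that] l
    by (simp add: divide_simps) (simp add: algebra_simps eval_nat_numeral)
  have cont: "continuous_on ?I (\<lambda>t. \<bar>\<alpha> t\<bar> + \<bar>\<beta> t\<bar>)"
    using da db by (intro continuous_intros DERIV_continuous_on) blast+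
  \<comment> \<open>Bootstrap: the maximum \<open>M\<close> of |\<alpha>| + |\<beta>| bounds u/g,
    hence through \<open>K\<close> the derivatives of \<open>\<alpha>\<close> and
    \<open>\<beta>\<close>, and hence \<open>M\<close> itself in terms of
    \<open>\<alpha> 0\<close>.\<close>
  obtain t0 where t0: "t0 \<in> ?I" "\<And>t. t \<in> ?I \<Longrightarrow> \<bar>\<alpha> t\<bar> + \<bar>\<beta> t\<bar> \<le> \<bar>\<alpha> t0\<bar> + \<bar>\<beta> t0\<bar>"
    using continuous_attains_sup[OF _ _ cont] T by auto
  define M where "M = \<bar>\<alpha> t0\<bar> + \<bar>\<beta> t0\<bar>"
  have M: "\<bar>\<alpha> t\<bar> + \<bar>\<beta> t\<bar> \<le> M" if "t \<in> ?I" for t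
    using t0(2)[OF that] by (simp add: M_def)
  have "0 \<le> K"
    using K[of 0] T by (meson abs_ge_zero atLeastAtMost_iff le_cases neg_le_0_iff_le order_trans less_imp_le)
  have M0: "0 \<le> M" by (simp add: M_def)
  have ug: "\<bar>u t * g'' t\<bar> \<le> K * M" if "t \<in> ?I" for t
  proof -
    have "\<bar>\<alpha> t * sin (\<phi> t) - \<beta> t * cos (\<phi> t)\<bar> \<le> \<bar>\<alpha> t * sin (\<phi> t)\<bar> + \<bar>\<beta> t * cos (\<phi> t)\<bar>"
      by linarith
    also have "\<dots> \<le> \<bar>\<alpha> t\<bar> + \<bar>\<beta> t\<bar>"
      by (intro add_mono) (simp_all add: abs_mult mult_left_le)
    finally have "\<bar>\<alpha> t * sin (\<phi> t) - \<beta> t * cos (\<phi> t)\<bar> \<le> M"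
      using M[OF that] by linarith
    then have "\<bar>g t * g'' t\<bar> * \<bar>\<alpha> t * sin (\<phi> t) - \<beta> t * cos (\<phi> t)\<bar> \<le> K * M"
      using K[OF that] M0 \<open>0 \<le> K\<close> by (intro mult_mono) auto
    then show ?thesis
      unfolding decomp[OF that] by (simp add: abs_mult mult_ac)
  qed
  have bnd: "\<bar>f t - f 0\<bar> \<le> K * M / l * T"
    if "t \<in> ?I" and "\<And>t. t \<in> ?I \<Longrightarrow> (f has_real_derivative - (u t * g'' t * c t) / l) (at t within ?I)"
      and "\<And>t. \<bar>c t\<bar> \<le> 1" for f c t
  proof -
    have "\<bar>- (u t * g'' t * c t) / l\<bar> \<le> K * M / l" if "t \<in> ?I" for t
    proof -
      have "\<bar>u t * g'' t\<bar> * \<bar>c t\<bar> \<le> K * M * 1"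
        using ug[OF that] \<open>\<And>t. \<bar>c t\<bar> \<le> 1\<close> M0 \<open>0 \<le> K\<close> by (intro mult_mono) auto
      then show ?thesis
        using l by (simp add: abs_mult divide_right_mono)
    qed
    then have "norm (f t - f 0) \<le> K * M / l * norm (t - 0)"
      using that T by (intro field_differentiable_bound[of ?I f]) auto
    also have "\<dots> \<le> K * M / l * T"
      using that l M0 \<open>0 \<le> K\<close> by (intro mult_left_mono) auto
    finally show ?thesis by simp
  qed
  have b0: "\<beta> 0 = 0" and a0: "\<alpha> 0 = u' 0 * g 0 / l"
    by (simp_all add: \<alpha>_def \<beta>_def init)
  have A: "\<bar>\<alpha> t - \<alpha> 0\<bar> \<le> K * M / l * T" and B: "\<bar>\<beta> t\<bar> \<le> K * M / l * T" if "t \<in> ?I" for t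
    using bnd[OF that da] bnd[OF that db] b0 by auto
  have "M \<le> \<bar>\<alpha> 0\<bar> + 2 * (K * M / l * T)"
    using A[OF t0(1)] B[OF t0(1)] M_def by linarith
  \<comment> \<open>By \<open>small\<close> the total drift is at most M/2 and can be absorbed into
    the left-hand side.\<close>
  moreover have "4 * (K * M / l * T) \<le> M"
    using mult_right_mono[OF small M0] l by (simp add: field_simps)
  ultimately have "M \<le> 2 * \<bar>\<alpha> 0\<bar>" by linarith
  have "\<bar>(\<alpha> t - \<alpha> 0) * sin (\<phi> t) - \<beta> t * cos (\<phi> t)\<bar> \<le> \<bar>(\<alpha> t - \<alpha> 0) * sin (\<phi> t)\<bar> + \<bar>\<beta> t * cos (\<phi> t)\<bar>"
    by linarith
  also have "\<dots> \<le> \<bar>\<alpha> t - \<alpha> 0\<bar> + \<bar>\<beta> t\<bar>"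
    by (intro add_mono) (simp_all add: abs_mult mult_left_le)
  also have "\<dots> \<le> 2 * (K * T / l) * M"
    using add_mono[OF A[OF t] B[OF t]] by (simp add: field_simps)
  also have "\<dots> \<le> 2 * (K * T / l) * (2 * \<bar>\<alpha> 0\<bar>)"
    using \<open>M \<le> 2 * \<bar>\<alpha> 0\<bar>\<close> \<open>0 \<le> K\<close> T l by (intro mult_left_mono) auto
  finally have "g t * \<bar>(\<alpha> t - \<alpha> 0) * sin (\<phi> t) - \<beta> t * cos (\<phi> t)\<bar> \<le> g t * (2 * (K * T / l) * (2 * \<bar>\<alpha> 0\<bar>))"
    using gpos[OF t] by (intro mult_left_mono) auto
  moreover have "u t - \<alpha> 0 * g t * sin (\<phi> t) = g t * ((\<alpha> t - \<alpha> 0) * sin (\<phi> t) - \<beta> t * cos (\<phi> t))"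
    unfolding decomp[OF t] by (simp add: algebra_simps)
  ultimately show ?thesis
    using gpos[OF t] unfolding a0[symmetric] by (simp add: abs_mult mult_ac)
qed

section \<open>The asymptotics\<close>

text \<open>In this form the derivatives of the potential are polynomials in \<open>tanh t\<close>,
  which is bounded by 1.\<close>

lemma DERIV_sech_squared:
  "((\<lambda>t. 1 / (cosh t)\<^sup>2 - \<delta>) has_real_derivative - 2 * (tanh t * (1 - (tanh t)\<^sup>2))) (at t)"
  for t :: real
  unfolding sech_squared by (auto intro!: derivative_eq_intros)

lemma DERIV_tanh_sech_squared:
  "((\<lambda>t. tanh t * (1 - (tanh t)\<^sup>2)) has_real_derivative (1 - 3 * (tanh t)\<^sup>2) * (1 - (tanh t)\<^sup>2)) (at t)"
  for t :: real
  by (auto intro!: derivative_eq_intros simp: algebra_simps power2_eq_square)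

text \<open>The estimate above with l = \<lambda> and g = q^(-1/4): then l^2/g^4 = l^2 q is the
  potential and l/g^2 = l sqrt q the derivative of the phase, while \<open>W\<close> is u'(0) g(0)
  g(t) / \<lambda>. With w = -q'/2 one has g g'' = 5/4 q^(-5/2) w^2 + 1/2 q^(-3/2) w', and
  \<open>K\<close> bounds this because |w| \<le> 1, |w'| \<le> 2 and q \<ge> c.\<close>

lemma polyP_liouville_green:
  fixes n m :: nat and T c t :: real
  assumes "n \<le> m" and T: "T > 0" and c: "c > 0"
  defines "q \<equiv> \<lambda>t. 1 / (cosh t)\<^sup>2 - (real (m - n))\<^sup>2 / (lam n m)\<^sup>2"
    and "K \<equiv> 5 / 4 * c powr (- 5 / 2) + c powr (- 3 / 2)"
  assumes q: "\<And>t. t \<in> {-T..T} \<Longrightarrow> q t \<ge> c" and small: "4 * K * T \<le> lam n m" and t: "t \<in> {-T..T}"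
  defines "W \<equiv> (-1) ^ n * (fact (2 * n + 1) / (fact n * fact m))
    * q t powr (- 1 / 4) * q 0 powr (- 1 / 4) * (2 / lam n m)"
  shows "\<bar>polyP (2 * n + 1) (m - n) (sinh t) / cosh t ^ (n + m + 1) - W * sin (phase n m (sinh t))\<bar>
    \<le> \<bar>W\<bar> * (4 * K * T / lam n m)"
proof -
  let ?I = "{-T..T}" and ?l = "lam n m"
  define u where "u t = polyP (2 * n + 1) (m - n) (sinh t) / cosh t ^ (n + m + 1)" for t
  define u' where "u' t = (polyP' (2 * n + 1) (m - n) (sinh t) * cosh t
    - (n + m + 1) * polyP (2 * n + 1) (m - n) (sinh t) * tanh t) / cosh t ^ (n + m + 1)" for t
  define w where "w t = tanh t * (1 - (tanh t)\<^sup>2)" for t :: real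
  define w' where "w' t = (1 - 3 * (tanh t)\<^sup>2) * (1 - (tanh t)\<^sup>2)" for t :: real
  define g where "g t = q t powr (- 1 / 4)" for t
  define g' where "g' t = q t powr (- 5 / 4) * w t / 2" for t
  define g'' where "g'' t = 5 / 4 * q t powr (- 9 / 4) * (w t)\<^sup>2 + q t powr (- 5 / 4) * w' t / 2" for t
  have l: "?l > 0"
    using lam_gt[of n m] by simp
  have qpos: "q t > 0" if "t \<in> ?I" for t
    using q[OF that] c by simp
  have dq: "(q has_real_derivative - 2 * w t) (at t within ?I)" for t
    unfolding q_def w_def by (rule has_field_derivative_at_within[OF DERIV_sech_squared])
  have dw: "(w has_real_derivative w' t) (at t within ?I)" for t
    unfolding w_def[abs_def] w'_def by (rule has_field_derivative_at_within[OF DERIV_tanh_sech_squared])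
  have dqr: "((\<lambda>t. q t powr r) has_real_derivative r * q t powr (r - 1) * (- 2 * w t)) (at t within ?I)"
    if "t \<in> ?I" for t r
    using DERIV_chain2[OF has_real_derivative_powr[OF qpos[OF that], of r] dq] .
  have dg: "(g has_real_derivative g' t) (at t within ?I)" if "t \<in> ?I" for t
    using dqr[OF that, of "- 1 / 4"] by (simp add: g_def[abs_def] g'_def mult.commute)
  have dg': "(g' has_real_derivative g'' t) (at t within ?I)" if "t \<in> ?I" for t
    unfolding g'_def[abs_def] g''_def
    by (rule derivative_eq_intros dqr[OF that] dw refl | simp)+ (simp add: power2_eq_square)
  have du: "(u has_real_derivative u' t) (at t within ?I)" for t
    unfolding u_def[abs_def] u'_def
    by (rule has_field_derivative_at_within[OF liouville_normal_form(1)[OF \<open>n \<le> m\<close>]])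
  have g4: "g t ^ 4 = 1 / q t" and g2: "(g t)\<^sup>2 = 1 / sqrt (q t)" if "t \<in> ?I" for t
  proof -
    have "g t ^ 4 = q t powr (- 1)" "(g t)\<^sup>2 = q t powr (- (1 / 2))"
      using qpos[OF that] by (simp_all add: g_def powr_power)
    then show "g t ^ 4 = 1 / q t" "(g t)\<^sup>2 = 1 / sqrt (q t)"
      using qpos[OF that] by (simp_all add: powr_minus_divide powr_half_sqrt)
  qed
  have du': "(u' has_real_derivative - (?l\<^sup>2 / g t ^ 4) * u t) (at t within ?I)" if "t \<in> ?I" for t
  proof -
    have "?l\<^sup>2 / g t ^ 4 = ?l\<^sup>2 / (cosh t)\<^sup>2 - (real (m - n))\<^sup>2"
      using l by (simp add: g4[OF that] q_def algebra_simps)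
    with has_field_derivative_at_within[OF liouville_normal_form(2)[OF \<open>n \<le> m\<close>], of t ?I]
    show ?thesis
      by (simp add: u_def u'_def[abs_def])
  qed
  have dphi: "((\<lambda>t. phase n m (sinh t)) has_real_derivative ?l / (g t)\<^sup>2) (at t within ?I)" if "t \<in> ?I" for t
  proof -
    \<comment> \<open>The integral is oriented and its base point 0 lies inside the interval, so one
      application of the fundamental theorem covers both signs of t.\<close>
    have "((\<lambda>t. LBINT \<tau>=ereal 0..ereal t. sqrt (q \<tau>)) has_vector_derivative sqrt (q t)) (at t within ?I)"
      using that T unfolding q_def
      by (intro interval_integral_FTC2 continuous_intros) auto
    then have "((\<lambda>t. ?l * (LBINT \<tau>=0..ereal t. sqrt (q \<tau>))) has_real_derivative ?l * sqrt (q t)) (at t within ?I)"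
      by (intro DERIV_cmult) (simp add: has_real_derivative_iff_has_vector_derivative zero_ereal_def)
    then show ?thesis
      by (simp add: phase_def q_def g2[OF that] arsinh_sinh_real)
  qed
  have gpos: "g t > 0" if "t \<in> ?I" for t
    using qpos[OF that] by (simp add: g_def)
  have K: "\<bar>g t * g'' t\<bar> \<le> K" if "t \<in> ?I" for t
  proof -
    have th: "(tanh t)\<^sup>2 \<le> 1"
      using tanh_real_lt_1[of t] tanh_real_gt_neg1[of t] by (simp add: abs_square_le_1)
    then have "\<bar>1 - (tanh t)\<^sup>2\<bar> \<le> 1" "\<bar>1 - 3 * (tanh t)\<^sup>2\<bar> \<le> 2"
      using zero_le_power2[of "tanh t"] by linarith+
    then have w: "(w t)\<^sup>2 \<le> 1" and w': "\<bar>w' t\<bar> \<le> 2"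
      using th mult_mono[of "\<bar>tanh t\<bar>" 1 "\<bar>1 - (tanh t)\<^sup>2\<bar>" 1]
        mult_mono[of "\<bar>1 - 3 * (tanh t)\<^sup>2\<bar>" 2 "\<bar>1 - (tanh t)\<^sup>2\<bar>" 1]
      by (simp_all add: w_def w'_def abs_mult abs_square_le_1)
    have pw: "q t powr r \<le> c powr r" if "r \<le> 0" for r
      using powr_mono2'[OF that c q[OF \<open>t \<in> ?I\<close>]] .
    have "g t * g'' t = 5 / 4 * q t powr (- 5 / 2) * (w t)\<^sup>2 + q t powr (- 3 / 2) * (w' t / 2)"
      by (simp add: g_def g''_def algebra_simps flip: powr_add)
    moreover have "\<bar>5 / 4 * q t powr (- 5 / 2) * (w t)\<^sup>2\<bar> \<le> 5 / 4 * c powr (- 5 / 2) * 1"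
      unfolding abs_mult using w pw[of "- 5 / 2"] by (intro mult_mono) auto
    moreover have "\<bar>q t powr (- 3 / 2) * (w' t / 2)\<bar> \<le> c powr (- 3 / 2) * 1"
      unfolding abs_mult using w' pw[of "- 3 / 2"] by (intro mult_mono) auto
    ultimately show ?thesis
      unfolding K_def by linarith
  qed
  have u0: "u 0 = 0"
    using polyP_odd_0[of n "m - n"] by (simp add: u_def)
  have phi0: "phase n m (sinh 0) = 0"
    by (simp add: phase_def flip: zero_ereal_def)
  have "u' 0 = (-1) ^ n * (2 * fact (2 * n + 1) / (fact n * fact m))"
    using polyP'_odd_0[of n "m - n"] \<open>n \<le> m\<close> by (simp add: u'_def)
  then have W: "u' 0 * g 0 / ?l * g t = W"
    by (simp add: W_def g_def)
  show ?thesis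
    using liouville_green_estimate[of T ?l K u u' g g' g'' "\<lambda>t. phase n m (sinh t)" t,
        OF T l small du du' dg dg' dphi gpos K u0 phi0 t] gpos[OF t]
    unfolding W by (simp add: u_def W[symmetric] abs_mult)
qed

section \<open>Uniform remainder on bounded sets of x\<close>

theorem theorem5p2:
  fixes m :: "nat \<Rightarrow> nat"
  assumes m_ge: "\<And>n. n \<le> m n"
    and s_small: "(\<lambda>n. real (m n - n) / lam n (m n)) \<longlonglongrightarrow> 0"
  shows "\<exists>R :: nat \<Rightarrow> real \<Rightarrow> real. \<forall>B :: real set. bounded B \<longrightarrow>
    (\<exists>C :: real. \<forall>\<^sub>F n in sequentially. \<forall>x\<in>B.
       polyP (2 * n + 1) (m n - n) x =
         (-1) ^ n * (fact (2 * n + 1) / (fact n * fact (m n)))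
         * (1 + x\<^sup>2) powr (real (n + m n + 1) / 2)
         * (1 / (1 + x\<^sup>2) - (real (m n - n))\<^sup>2 / (lam n (m n))\<^sup>2) powr (- 1 / 4)
         * (1 - (real (m n - n))\<^sup>2 / (lam n (m n))\<^sup>2) powr (- 1 / 4)
         * (2 / lam n (m n))
         * (sin (phase n (m n) x) + R n x)
       \<and> \<bar>R n x\<bar> \<le> C / real (n + m n))"
proof -
  define A where "A n x = (-1) ^ n * (fact (2 * n + 1) / (fact n * fact (m n)))
         * (1 + x\<^sup>2) powr (real (n + m n + 1) / 2)
         * (1 / (1 + x\<^sup>2) - (real (m n - n))\<^sup>2 / (lam n (m n))\<^sup>2) powr (- 1 / 4)
         * (1 - (real (m n - n))\<^sup>2 / (lam n (m n))\<^sup>2) powr (- 1 / 4)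
         * (2 / lam n (m n))" for n x
  \<comment> \<open>As a quotient, \<open>R\<close> does not depend on the bounded set. Division by
    \<open>A n x\<close> is meaningful only where it is nonzero, which holds on each bounded set for
    all large n.\<close>
  define R where "R n x = polyP (2 * n + 1) (m n - n) x / A n x - sin (phase n (m n) x)" for n x
  have "\<exists>C. \<forall>\<^sub>F n in sequentially. \<forall>x\<in>B. polyP (2 * n + 1) (m n - n) x =
      A n x * (sin (phase n (m n) x) + R n x) \<and> \<bar>R n x\<bar> \<le> C / real (n + m n)"
    if "bounded B" for B
  proof -
    obtain b where b: "b > 0" "\<And>x. x \<in> B \<Longrightarrow> \<bar>x\<bar> \<le> b"
      using \<open>bounded B\<close> unfolding bounded_pos by auto
    define T where "T = arsinh b"
    \<comment> \<open>Half of the minimum 1/(1 + b^2) of 1/cosh^2 on [-T, T]; the other half is left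
      for s^2/\<lambda>^2, which tends to 0.\<close>
    define c where "c = 1 / (1 + b\<^sup>2) / 2"
    define K where "K = 5 / 4 * c powr (- 5 / 2) + c powr (- 3 / 2)"
    have T: "T > 0" and c: "c > 0"
      using b(1) by (simp_all add: T_def c_def add_pos_nonneg)
    have K: "K \<ge> 0"
      by (simp add: K_def)
    have "(\<lambda>n. (real (m n - n) / lam n (m n))\<^sup>2) \<longlonglongrightarrow> 0"
      using tendsto_power[OF s_small, of 2] by simp
    then have "\<forall>\<^sub>F n in sequentially. (real (m n - n) / lam n (m n))\<^sup>2 < c"
      using c by (rule order_tendstoD)
    \<comment> \<open>As \<lambda> > n + m \<ge> n, a bound by n ensures the smallness condition on
      \<lambda>; n > 0 keeps the denominator n + m positive.\<close>
    moreover have "\<forall>\<^sub>F n in sequentially. n > 0 \<and> 4 * K * T \<le> real n"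
      by (intro eventually_conj eventually_gt_at_top eventually_compose_filterlim[OF _ filterlim_real_sequentially]
            eventually_ge_at_top)
    ultimately have "\<forall>\<^sub>F n in sequentially. \<forall>x\<in>B. polyP (2 * n + 1) (m n - n) x =
      A n x * (sin (phase n (m n) x) + R n x) \<and> \<bar>R n x\<bar> \<le> 4 * K * T / real (n + m n)"
    proof eventually_elim
      case (elim n)
      show ?case
      proof
        fix x assume "x \<in> B"
        define t where "t = arsinh x"
        define q where "q t = 1 / (cosh t)\<^sup>2 - (real (m n - n))\<^sup>2 / (lam n (m n))\<^sup>2" for t
        define W where "W = (-1) ^ n * (fact (2 * n + 1) / (fact n * fact (m n)))
          * q t powr (- 1 / 4) * q 0 powr (- 1 / 4) * (2 / lam n (m n))"
        have x: "x = sinh t"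
          by (simp add: t_def)
        have l: "real (n + m n) < lam n (m n)"
          using lam_gt[of n "m n"] by simp
        have q: "q t \<ge> c" if "t \<in> {-T..T}" for t
        proof -
          have "sinh (-T) \<le> sinh t" "sinh t \<le> sinh T"
            using that by (simp_all only: sinh_real_le_iff) auto
          then have "\<bar>sinh t\<bar> \<le> \<bar>b\<bar>"
            by (simp add: T_def)
          then have "(cosh t)\<^sup>2 \<le> 1 + b\<^sup>2"
            unfolding abs_le_square_iff by (simp add: cosh_square_eq)
          then have "1 / (1 + b\<^sup>2) \<le> 1 / (cosh t)\<^sup>2"
            by (intro divide_left_mono) (auto simp: add_pos_nonneg)
          moreover have "1 / (1 + b\<^sup>2) = 2 * c"
            using field_sum_of_halves[of "1 / (1 + b\<^sup>2)"] by (simp only: c_def mult_2)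
          ultimately show ?thesis
            using elim by (simp add: q_def power_divide)
        qed
        have t: "t \<in> {-T..T}"
        proof -
          have "sinh (-T) \<le> sinh t" "sinh t \<le> sinh T"
            using b(2)[OF \<open>x \<in> B\<close>] by (auto simp: T_def t_def)
          then show ?thesis
            by (simp only: sinh_real_le_iff) auto
        qed
        have "\<bar>polyP (2 * n + 1) (m n - n) x / cosh t ^ (n + m n + 1) - W * sin (phase n (m n) x)\<bar>
            \<le> \<bar>W\<bar> * (4 * K * T / lam n (m n))"
          unfolding x W_def K_def q_def using q t elim l
          by (intro polyP_liouville_green[OF m_ge T c]) (auto simp: q_def K_def)
        moreover have "\<bar>W\<bar> * (4 * K * T / lam n (m n)) \<le> \<bar>W\<bar> * (4 * K * T / real (n + m n))"
          using elim l K T by (intro mult_left_mono divide_left_mono) auto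
        ultimately have est: "\<bar>polyP (2 * n + 1) (m n - n) x / cosh t ^ (n + m n + 1) - W * sin (phase n (m n) x)\<bar>
            \<le> \<bar>W\<bar> * (4 * K * T / real (n + m n))"
          by linarith
        \<comment> \<open>Positivity of q at t and at 0 makes the amplitude nonzero, so that the
          error can be divided by it.\<close>
        have "W \<noteq> 0"
          using q[OF t] q[of 0] c T l by (auto simp: W_def)
        have ch: "1 + x\<^sup>2 = (cosh t)\<^sup>2"
          by (simp add: x cosh_square_eq)
        have "(1 + x\<^sup>2) powr (real (n + m n + 1) / 2) = cosh t ^ (n + m n + 1)"
        proof -
          have "(1 + x\<^sup>2) powr (real (n + m n + 1) / 2) = (cosh t powr 2) powr (real (n + m n + 1) / 2)"
            unfolding ch by simp
          also have "\<dots> = cosh t powr real (n + m n + 1)"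
            unfolding powr_powr by (rule arg_cong[of _ _ "(powr) (cosh t)"]) (simp add: field_simps)
          also have "\<dots> = cosh t ^ (n + m n + 1)"
            by (rule powr_realpow) simp
          finally show ?thesis .
        qed
        then have A: "A n x = W * cosh t ^ (n + m n + 1)"
          unfolding A_def W_def q_def ch by simp
        have "A n x \<noteq> 0"
          using \<open>W \<noteq> 0\<close> by (simp add: A)
        then have eq: "polyP (2 * n + 1) (m n - n) x = A n x * (sin (phase n (m n) x) + R n x)"
          by (simp add: R_def)
        have "polyP (2 * n + 1) (m n - n) x / cosh t ^ (n + m n + 1) = W * (sin (phase n (m n) x) + R n x)"
          unfolding eq A by (subst nonzero_divide_eq_eq) (simp_all only: mult_ac, simp)
        then have "polyP (2 * n + 1) (m n - n) x / cosh t ^ (n + m n + 1) - W * sin (phase n (m n) x) = W * R n x"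
          by (simp only: distrib_left add_diff_cancel_left')
        with est have "\<bar>W\<bar> * \<bar>R n x\<bar> \<le> \<bar>W\<bar> * (4 * K * T / real (n + m n))"
          by (simp add: abs_mult)
        then have "\<bar>R n x\<bar> \<le> 4 * K * T / real (n + m n)"
          by (rule mult_left_le_imp_le) (use \<open>W \<noteq> 0\<close> in simp)
        with eq show "polyP (2 * n + 1) (m n - n) x = A n x * (sin (phase n (m n) x) + R n x)
            \<and> \<bar>R n x\<bar> \<le> 4 * K * T / real (n + m n)" by simp
      qed
    qed
    then show ?thesis by blast
  qed
  then show ?thesis
    unfolding A_def by blast
qed

end
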